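(* Let $\psi_\theta^{(d)}$ denote the $d$-th derivative of the generator $\psi_\theta$ with respect to $t$ (with $\psi_\theta^{(0)}=\psi_\theta$), and put $\alpha=1/\theta$ (for $\theta>0$). The following hold. (1) (Ali-Mikhail-Haq) Let $\theta\in[0,1)$ and $\psi_\theta(t)=(1-\theta)/(\exp(t)-\theta)$. Then for all $t\in(0,\infty)$ and all integers $d\ge 0$, $$(-1)^d\psi_\theta^{(d)}(t)=\frac{1-\theta}{\theta}\,\mathrm{Li}_{-d}(\theta\exp(-t)),$$ where for $\theta=0$ the right-hand side is understood as its limit as $\theta\downarrow0$. (2) (Clayton) Let $\theta\in(0,\infty)$ and $\psi_\theta(t)=(1+t)^{-1/\theta}$. Then for all $t\in(0,\infty)$ and all integers $d\ge0$, $$(-1)^d\psi_\theta^{(d)}(t)=(d-1+1/\theta)_d\,(1+t)^{-(d+1/\theta)},$$ where $(d-1+1/\theta)_d=\prod_{k=0}^{d-1}(k+1/\theta)=\frac{\Gamma(d+1/\theta)}{\Gamma(1/\theta)}$. (3) (Frank) Let $\theta\in(0,\infty)$ and $\psi_\theta(t)=-\log\bigl(1-(1-e^{-\theta})\exp(-t)\bigr)/\theta$. Then for all $t\in(0,\infty)$ and all integers $d\ge0$, $$(-1)^d\psi_\theta^{(d)}(t)=\frac1\theta\,\mathrm{Li}_{-(d-1)}\bigl((1-e^{-\theta})\exp(-t)\bigr).$$ (4) (Gumbel) Let $\theta\in[1,\infty)$ and $\psi_\theta(t)=\exp(-t^{1/\theta})$. Then for all $t\in(0,\infty)$ and all integers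 $d\ge1$, $$(-1)^d\psi_\theta^{(d)}(t)=\frac{\psi_\theta(t)}{t^d}\,P^{\mathrm G}_{d,\theta}(t^\alpha),\qquad P^{\mathrm G}_{d,\theta}(x)=\sum_{k=1}^d a^{\mathrm G}_{dk}(\theta)x^k,$$ where, for $k\in\{1,\dots,d\}$, $$a^{\mathrm G}_{dk}(\theta)=(-1)^{d-k}\sum_{j=k}^d\theta^{-j}s(d,j)S(j,k)=\frac{d!}{k!}\sum_{j=1}^k\binom{k}{j}\binom{\alpha j}{d}(-1)^{d-j}.$$ (5) (Joe) Let $\theta\in[1,\infty)$ and $\psi_\theta(t)=1-(1-\exp(-t))^{1/\theta}$. Then for all $t\in(0,\infty)$ and all integers $d\ge1$, $$(-1)^d\psi_\theta^{(d)}(t)=\frac{\exp(-t)}{\theta(1-\exp(-t))^{1-1/\theta}}\,P^{\mathrm J}_{d,\theta}\Bigl(\frac{\exp(-t)}{1-\exp(-t)}\Bigr),\qquad P^{\mathrm J}_{d,\theta}(x)=\sum_{k=1}^d a^{\mathrm J}_{dk}(\theta)x^{k-1},$$ where, for $k\in\{1,\dots,d\}$, $$a^{\mathrm J}_{dk}(\theta)=S(d,k)\,(k-1-1/\theta)_{k-1}=S(d,k)\frac{\Gamma(k-\alpha)}{\Gamma(1-\alpha)},$$ the last expression being understood, for $\theta=1$, as its limit as $\theta\downarrow1$.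
   Context: $\mathrm{Li}_s(z)=\sum_{k=1}^\infty z^k/k^s$ ($|z|<1$) is the polylogarithm of order $s$ at $z$. For real $x$ and an integer $n\ge0$, $(x)_n=\prod_{i=0}^{n-1}(x-i)$ is the falling factorial (empty product equal to $1$), and $\binom{x}{n}=(x)_n/n!$ is the generalized binomial coefficient. $s(d,j)$ denotes the (signed) Stirling numbers of the first kind, i.e. $(x)_d=\sum_{j=0}^d s(d,j)x^j$, and $S(j,k)$ denotes the Stirling numbers of the second kind. $\Gamma$ is the Gamma function. The five functions $\psi_\theta$ are the Archimedean generators of the named one-parameter families, with the stated parameter ranges. *)

theory Defs
  imports "HOL-Analysis.Analysis" "HOL-Combinatorics.Stirling" "HOL-Real_Asymp.Real_Asymp"
begin

definition polylog :: "real \<Rightarrow> real \<Rightarrow> real" where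
  "polylog s z = (\<Sum>k. z ^ Suc k / real (Suc k) powr s)"

lemma summable_polylog:
  fixes s z :: real
  assumes "\<bar>z\<bar> < 1"
  shows "summable (\<lambda>k. z ^ Suc k / real (Suc k) powr s)"
proof (rule summable_comparison_test_bigo)
  define q where "q = (1 + \<bar>z\<bar>) / 2"
  have q: "\<bar>z\<bar> < q" "0 < q" "q < 1"
    using assms by (auto simp: q_def)
  show "summable (\<lambda>k. norm (q ^ k))"
    using q by (simp add: summable_geometric)
  show "(\<lambda>k. z ^ Suc k / real (Suc k) powr s) \<in> O(\<lambda>k. q ^ k)"
  proof (cases "z = 0")
    case False
    define r where "r = \<bar>z\<bar>"
    have r: "0 < r" "r < q"
      using False q by (auto simp: r_def)
    have "(\<lambda>k. r ^ Suc k / real (Suc k) powr s) \<in> O(\<lambda>k. q ^ k)"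
    proof -
      define c where "c = ln (q / r)"
      have c: "c > 0" "\<And>k. q ^ k = r ^ k * exp (c * real k)"
        using r by (simp_all add: c_def exp_of_nat2_mult power_divide)
      have "(\<lambda>k. r * (1 / (real (Suc k) powr s * exp (c * real k)))) \<in> O(\<lambda>_. 1)"
        using c(1) r(1) by real_asymp
      from landau_o.big.mult [OF landau_o.big_refl [of "\<lambda>k. q ^ k"] this] show ?thesis
        using c(2) by (simp add: field_simps)
    qed
    moreover have "norm (z ^ Suc k / real (Suc k) powr s) = norm (r ^ Suc k / real (Suc k) powr s)" for k
      by (simp add: r_def abs_mult power_abs)
    ultimately have "(\<lambda>k. \<bar>z ^ Suc k / real (Suc k) powr s\<bar>) \<in> O(\<lambda>k. q ^ k)"
      by (simp only: landau_o.big.abs_in_iff real_norm_def)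
    then show ?thesis
      by (simp only: landau_o.big.abs_in_iff real_norm_def)
  qed simp
qed

definition falling_fact :: "real \<Rightarrow> nat \<Rightarrow> real" where
  "falling_fact x n = (\<Prod>i<n. x - real i)"

text \<open>The library's \<^const>\<open>stirling\<close> is the unsigned variant. The next lemma shows
  that the signed numbers are the coefficients of the falling factorial.\<close>

definition signed_stirling :: "nat \<Rightarrow> nat \<Rightarrow> int" where
  "signed_stirling d j = (-1) ^ (d + j) * int (stirling d j)"

lemma falling_fact_signed_stirling:
  "falling_fact x d = (\<Sum>j\<le>d. real_of_int (signed_stirling d j) * x ^ j)"
proof -
  have "falling_fact x d = (\<Prod>i<d. (-1) * (- x + real i))"
    by (simp add: falling_fact_def)
  also have "\<dots> = (-1) ^ d * pochhammer (- x) d"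
    by (simp only: prod.distrib prod_constant pochhammer_prod card_lessThan lessThan_atLeast0)
       simp
  also have "\<dots> = (\<Sum>j\<le>d. real_of_int (signed_stirling d j) * x ^ j)"
    by (simp add: stirling_pochhammer [symmetric] sum_distrib_left signed_stirling_def
          power_add power_minus [of x] mult_ac)
  finally show ?thesis .
qed

lemma gchoose_falling_fact: "(x :: real) gchoose n = falling_fact x n / fact n"
  by (simp add: gbinomial_prod_rev falling_fact_def lessThan_atLeast0)

definition psi_AMH :: "real \<Rightarrow> real \<Rightarrow> real" where
  "psi_AMH \<theta> t = (1 - \<theta>) / (exp t - \<theta>)"

definition psi_Clayton :: "real \<Rightarrow> real \<Rightarrow> real" where
  "psi_Clayton \<theta> t = (1 + t) powr (- (1 / \<theta>))"

definition psi_Frank :: "real \<Rightarrow> real \<Rightarrow> real" where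
  "psi_Frank \<theta> t = - ln (1 - (1 - exp (- \<theta>)) * exp (- t)) / \<theta>"

definition psi_Gumbel :: "real \<Rightarrow> real \<Rightarrow> real" where
  "psi_Gumbel \<theta> t = exp (- (t powr (1 / \<theta>)))"

definition psi_Joe :: "real \<Rightarrow> real \<Rightarrow> real" where
  "psi_Joe \<theta> t = 1 - (1 - exp (- t)) powr (1 / \<theta>)"

definition a_Gumbel :: "nat \<Rightarrow> nat \<Rightarrow> real \<Rightarrow> real" where
  "a_Gumbel d k \<theta> = (-1) ^ (d - k) *
     (\<Sum>j=k..d. \<theta> powi (- int j) * real_of_int (signed_stirling d j) * real (Stirling j k))"

definition P_Gumbel :: "nat \<Rightarrow> real \<Rightarrow> real \<Rightarrow> real" where
  "P_Gumbel d \<theta> x = (\<Sum>k=1..d. a_Gumbel d k \<theta> * x ^ k)"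

definition a_Joe :: "nat \<Rightarrow> nat \<Rightarrow> real \<Rightarrow> real" where
  "a_Joe d k \<theta> = real (Stirling d k) * falling_fact (real k - 1 - 1 / \<theta>) (k - 1)"

definition P_Joe :: "nat \<Rightarrow> real \<Rightarrow> real \<Rightarrow> real" where
  "P_Joe d \<theta> x = (\<Sum>k=1..d. a_Joe d k \<theta> * x ^ (k - 1))"

text \<open>Since \<^const>\<open>deriv\<close> is total, a value of \<open>(deriv ^^ d) f t\<close> says nothing about the
  existence of the derivative; this predicate supplies it. It is meant to be used for all
  \<open>t\<close> in an open set.\<close>

definition times_differentiable_at :: "nat \<Rightarrow> (real \<Rightarrow> real) \<Rightarrow> real \<Rightarrow> bool" where
  "times_differentiable_at d f t \<longleftrightarrow> (\<forall>k<d. (deriv ^^ k) f field_differentiable at t)"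

end

theory Submission
  imports Defs
begin

text \<open>
  Each family is handled by exhibiting the whole sequence of functions
  \<open>g\<^sub>d = (-1)\<^sup>d \<psi>\<^sup>(\<^sup>d\<^sup>)\<close> at once: if \<open>g\<^sub>0 = \<psi>\<close> on \<open>(0,\<infinity>)\<close> and \<open>g\<^sub>d' = - g\<^bsub>d+1\<^esub>\<close>
  there, then \<open>\<psi>\<close> is infinitely often differentiable and its derivatives are as claimed
  (\<open>iterated_deriv_of_derivative_sequence\<close>). What remains is one first-order identity per family.

  For Ali-Mikhail-Haq and Frank the identity is \<open>z Li\<^sub>s'(z) = Li\<^bsub>s-1\<^esub>(z)\<close>, taken at
  \<open>z = c exp (-t)\<close>, where \<open>-d/dt\<close> acts as \<open>z d/dz\<close>; the start of the sequence is
  \<open>Li\<^sub>0(z) = z/(1-z)\<close> in the first case and \<open>Li\<^sub>1(z) = -ln (1-z)\<close> in the second. At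
  \<open>\<theta> = 0\<close> the Ali-Mikhail-Haq generator is \<open>exp (-t)\<close>, and the limit of the formula follows from
  \<open>Li\<^sub>s(z)/z \<longrightarrow> 1\<close> as \<open>z \<rightarrow> 0\<close>. For Clayton the identity is the derivative of a power.

  For Gumbel and Joe the Stirling numbers come from two operator identities, with \<open>D = d/dx\<close>:
  \<open>(x D)\<^sup>n = \<Sum>\<^sub>k S(n,k) x\<^sup>k D\<^sup>k\<close> and, conversely, \<open>x\<^sup>n D\<^sup>n = \<Sum>\<^sub>j s(n,j) (x D)\<^sup>j\<close>
  (\<open>euler_operator_power\<close> and \<open>derivative_from_euler_operator_powers\<close>).
  Joe's generator is \<open>1 - (1-u)\<^sup>\<alpha>\<close> at \<open>u = exp (-t)\<close>, so \<open>(-d/dt)\<^sup>d = (u d/du)\<^sup>d\<close> and the first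
  identity gives the claim. Gumbel's generator is \<open>exp (-x)\<close> at \<open>x = t\<^sup>\<alpha>\<close>, and here
  \<open>t d/dt = \<alpha> x d/dx\<close>; the second identity expresses \<open>t\<^sup>d (d/dt)\<^sup>d\<close> through powers of this
  operator, and the first one evaluates these on \<open>exp (-x)\<close>. The double sum over \<open>s(d,j) S(j,k)\<close>
  is the result. Its closed form follows from
  \<open>k! S(j,k) = \<Sum>\<^sub>i (-1)\<^bsup>k-i\<^esup> (k choose i) i\<^sup>j\<close>, since summing \<open>s(d,j) (\<alpha> i)\<^sup>j\<close> over \<open>j\<close>
  yields the falling factorial of \<open>\<alpha> i\<close>.
\<close>

section \<open>Iterated derivatives\<close>

lemma iterated_deriv_of_derivative_sequence:
  fixes f :: "real \<Rightarrow> real" and g :: "nat \<Rightarrow> real \<Rightarrow> real"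
  assumes S: "open S"
    and f: "\<And>t. t \<in> S \<Longrightarrow> f t = g 0 t"
    and g: "\<And>d t. t \<in> S \<Longrightarrow> (g d has_field_derivative - g (Suc d) t) (at t)"
    and t: "t \<in> S"
  shows "times_differentiable_at d f t" and "(-1) ^ d * (deriv ^^ d) f t = g d t"
proof -
  have step: "((deriv ^^ d) f has_field_derivative (-1) ^ Suc d * g (Suc d) t) (at t)"
    if "t \<in> S" "\<And>u. u \<in> S \<Longrightarrow> (deriv ^^ d) f u = (-1) ^ d * g d u" for d t
  proof (rule has_field_derivative_transform_within_open)
    show "((\<lambda>u. (-1) ^ d * g d u) has_field_derivative (-1) ^ Suc d * g (Suc d) t) (at t)"
      using DERIV_cmult [OF g [OF that(1), of d], of "(-1) ^ d"] by simp
  qed (use S that in auto)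
  have val: "(deriv ^^ d) f u = (-1) ^ d * g d u" if "u \<in> S" for d u
    using that
  proof (induction d arbitrary: u)
    case (Suc d)
    show ?case
      using DERIV_imp_deriv [OF step [OF Suc.prems Suc.IH]] by simp
  qed (simp add: f)
  show "times_differentiable_at d f t"
    unfolding times_differentiable_at_def field_differentiable_def using step [OF t val] by blast
  show "(-1) ^ d * (deriv ^^ d) f t = g d t"
    by (simp add: val [OF t] flip: mult.assoc power_mult_distrib)
qed

section \<open>The polylogarithm\<close>

text \<open>Term by term, \<open>z d/dz\<close> multiplies \<open>z\<^sup>k / k\<^sup>s\<close> by \<open>k\<close>. The derivative is written as a power
  series, and not as \<open>Li\<^bsub>s-1\<^esub>(z) / z\<close>, so that \<open>z = 0\<close> is included.\<close>

lemma has_field_derivative_polylog_series: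
  fixes s z :: real
  assumes "\<bar>z\<bar> < 1"
  shows "(polylog s has_field_derivative (\<Sum>k. z ^ k / real (Suc k) powr (s - 1))) (at z)"
proof -
  \<comment> \<open>At \<open>k = 0\<close> the value \<open>0 powr s = 0\<close> makes the constant coefficient vanish.\<close>
  define c where "c k = 1 / real k powr s" for k
  have c0: "c 0 = 0"
    by (simp add: c_def)
  have shifted: "(\<lambda>k. c (Suc k) * y ^ Suc k) = (\<lambda>k. y ^ Suc k / real (Suc k) powr s)" for y
    by (simp add: c_def)
  have sm: "summable (\<lambda>k. c k * y ^ k)" if "norm y < 1" for y
    using summable_polylog [of y s] that
    by (subst summable_Suc_iff [symmetric]) (simp only: shifted real_norm_def)
  have eq: "polylog s y = (\<Sum>k. c k * y ^ k)" if "y \<in> ball 0 1" for y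
  proof -
    have "(\<Sum>k. c (Suc k) * y ^ Suc k) = (\<Sum>k. c k * y ^ k) - c 0 * y ^ 0"
      by (rule suminf_split_head) (use sm that in simp)
    then show ?thesis
      by (simp only: shifted polylog_def c0)
  qed
  have "((\<lambda>y. \<Sum>k. c k * y ^ k) has_field_derivative (\<Sum>k. diffs c k * z ^ k)) (at z)"
    using termdiffs_strong' [of 1 c z] sm assms by simp
  also have "(\<lambda>k. diffs c k * z ^ k) = (\<lambda>k. z ^ k / real (Suc k) powr (s - 1))"
  proof
    fix k
    have "real (Suc k) powr (s - 1) = real (Suc k) powr s / real (Suc k)"
      by (simp only: powr_diff) simp
    then show "diffs c k * z ^ k = z ^ k / real (Suc k) powr (s - 1)"
      by (simp only: diffs_def c_def) simp
  qed
  finally show ?thesis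
    by (rule has_field_derivative_transform_within_open [where S = "ball 0 1"])
       (use assms eq in auto)
qed

lemma has_field_derivative_polylog:
  fixes s z :: real
  assumes "\<bar>z\<bar> < 1" "z \<noteq> 0"
  shows "(polylog s has_field_derivative polylog (s - 1) z / z) (at z)"
proof -
  have sm: "summable (\<lambda>k. z ^ Suc k / real (Suc k) powr (s - 1))"
    by (rule summable_polylog [OF assms(1)])
  have "(\<lambda>k. z ^ Suc k / real (Suc k) powr (s - 1) / z) = (\<lambda>k. z ^ k / real (Suc k) powr (s - 1))"
    using assms by (simp add: field_simps)
  then have "(\<Sum>k. z ^ k / real (Suc k) powr (s - 1)) = polylog (s - 1) z / z"
    using suminf_divide [OF sm, of z] by (simp add: polylog_def)
  then show ?thesis
    using has_field_derivative_polylog_series [OF assms(1), of s] by simp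
qed

lemma has_field_derivative_polylog_exp:
  assumes "0 < c" "c < 1" "0 < t"
  shows "((\<lambda>t. polylog s (c * exp (- t))) has_field_derivative
    - polylog (s - 1) (c * exp (- t))) (at t)"
proof -
  have "c * exp (- t) < 1 * 1"
    using assms by (intro mult_strict_mono) auto
  then have z: "\<bar>c * exp (- t)\<bar> < 1" "c * exp (- t) \<noteq> 0"
    using assms by auto
  have "((\<lambda>t. c * exp (- t)) has_field_derivative - (c * exp (- t))) (at t)"
    by (auto intro!: derivative_eq_intros)
  from DERIV_chain2 [OF has_field_derivative_polylog [OF z, of s] this] show ?thesis
    using z by simp
qed

lemma polylog_0:
  assumes "\<bar>z\<bar> < 1"
  shows "polylog 0 z = z / (1 - z)"
proof -
  have "polylog 0 z = (\<Sum>k. z * z ^ k)"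
    by (simp add: polylog_def)
  also have "\<dots> = z / (1 - z)"
    using assms by (simp add: suminf_mult summable_geometric suminf_geometric)
  finally show ?thesis .
qed

lemma polylog_1:
  assumes "0 < z" "z < 1"
  shows "polylog 1 z = - ln (1 - z)"
proof -
  have sm: "summable (\<lambda>k. z ^ Suc k / real (Suc k) powr 1)"
    by (rule summable_polylog) (use assms in auto)
  have summand: "(- 1) ^ k * (1 / real (k + 1)) * (- z) ^ Suc k = - (z ^ Suc k / real (Suc k) powr 1)" for k
  proof -
    have "(- z) ^ Suc k = (- 1) ^ Suc k * z ^ Suc k"
      by (rule power_minus)
    then show ?thesis
      by (simp del: power_Suc add: power_Suc [of "-1"] flip: power_mult_distrib mult.assoc)
  qed
  have "ln (1 - z) = (\<Sum>k. (- 1) ^ k * (1 / real (k + 1)) * (1 - z - 1) ^ Suc k)"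
    by (rule ln_series) (use assms in auto)
  also have "1 - z - 1 = - z"
    by simp
  finally have "ln (1 - z) = (\<Sum>k. - (z ^ Suc k / real (Suc k) powr 1))"
    by (simp only: summand)
  then show ?thesis
    by (simp only: polylog_def suminf_minus [OF sm] minus_minus)
qed

text \<open>The quotient is the difference quotient of \<open>Li\<^sub>s\<close> at \<open>0\<close>, and the constant term of the
  derivative series is \<open>1\<close>.\<close>

lemma polylog_over_argument_tendsto: "((\<lambda>z. polylog s z / z) \<longlongrightarrow> 1) (at 0)"
proof -
  have "(\<Sum>k. (0::real) ^ k / real (Suc k) powr (s - 1)) = 1"
    using powser_zero [of "\<lambda>k. 1 / real (Suc k) powr (s - 1)"] by simp
  moreover have "polylog s 0 = 0"
    by (simp add: polylog_def)
  ultimately show ?thesis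
    using has_field_derivative_polylog_series [of 0 s]
    by (simp add: has_field_derivative_iff)
qed

section \<open>Stirling numbers and the Euler operator\<close>

lemma sum_Stirling_Suc:
  fixes h :: "nat \<Rightarrow> real"
  shows "(\<Sum>k\<le>Suc n. real (Stirling (Suc n) k) * h k) =
    (\<Sum>k\<le>n. real (Stirling n k) * (real k * h k + h (Suc k)))"
proof -
  have "(\<Sum>k\<le>n. real (Suc k) * real (Stirling n (Suc k)) * h (Suc k)) =
      (\<Sum>k\<le>Suc n. real k * real (Stirling n k) * h k)"
    by (simp only: sum.atMost_Suc_shift)
  also have "\<dots> = (\<Sum>k\<le>n. real k * real (Stirling n k) * h k)"
    by simp
  finally show ?thesis
    by (simp only: sum.atMost_Suc_shift) (simp add: algebra_simps sum.distrib)
qed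

lemma signed_stirling_Suc_0 [simp]: "signed_stirling (Suc d) 0 = 0"
  by (simp add: signed_stirling_def)

lemma signed_stirling_less [simp]: "d < j \<Longrightarrow> signed_stirling d j = 0"
  by (simp add: signed_stirling_def)

lemma signed_stirling_Suc_Suc:
  "signed_stirling (Suc d) (Suc j) = signed_stirling d j - int d * signed_stirling d (Suc j)"
  by (simp add: signed_stirling_def algebra_simps)

lemma sum_signed_stirling_Suc:
  fixes h :: "nat \<Rightarrow> real"
  shows "(\<Sum>j\<le>Suc d. real_of_int (signed_stirling (Suc d) j) * h j) =
    (\<Sum>j\<le>d. real_of_int (signed_stirling d j) * (h (Suc j) - real d * h j))"
proof -
  \<comment> \<open>The shift adds a term \<open>d s(d,0)\<close>, which vanishes because either \<open>d\<close> or \<open>s(d,0)\<close> is zero.\<close>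
  have "real d * (\<Sum>j\<le>d. real_of_int (signed_stirling d (Suc j)) * h (Suc j)) =
      real d * (\<Sum>j\<le>Suc d. real_of_int (signed_stirling d j) * h j)"
    by (cases d) (simp_all only: sum.atMost_Suc_shift signed_stirling_Suc_0, simp_all)
  then have "real d * (\<Sum>j\<le>d. real_of_int (signed_stirling d (Suc j)) * h (Suc j)) =
      real d * (\<Sum>j\<le>d. real_of_int (signed_stirling d j) * h j)"
    by simp
  then show ?thesis
    by (simp only: sum.atMost_Suc_shift signed_stirling_Suc_Suc)
       (simp add: algebra_simps sum_subtractf sum_distrib_left)
qed

text \<open>With \<open>F k\<close> the \<open>k\<close>-th derivative of a function \<open>f\<close>, the sum is \<open>(x D)\<^sup>n f\<close>; the recurrence
  \<open>S(n+1,k) = k S(n,k) + S(n,k-1)\<close> is the effect of \<open>x D\<close> on \<open>x\<^sup>k F k\<close>.\<close>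

lemma euler_operator_power:
  fixes F :: "nat \<Rightarrow> real \<Rightarrow> real"
  assumes F: "\<And>k. (F k has_field_derivative F (Suc k) x) (at x)" and x: "x \<noteq> 0"
  shows "((\<lambda>x. \<Sum>k\<le>n. real (Stirling n k) * (x ^ k * F k x)) has_field_derivative
    (\<Sum>k\<le>Suc n. real (Stirling (Suc n) k) * (x ^ k * F k x)) / x) (at x)"
proof -
  have "((\<lambda>x. x ^ k * F k x) has_field_derivative
      (real k * (x ^ k * F k x) + x ^ Suc k * F (Suc k) x) / x) (at x)" for k
    by (rule derivative_eq_intros F refl)+ (use x in \<open>cases k; simp add: field_simps\<close>)
  from DERIV_sum [OF DERIV_cmult [OF this]]
  have "((\<lambda>x. \<Sum>k\<le>n. real (Stirling n k) * (x ^ k * F k x)) has_field_derivative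
      (\<Sum>k\<le>n. real (Stirling n k) *
        ((real k * (x ^ k * F k x) + x ^ Suc k * F (Suc k) x) / x))) (at x)" .
  then show ?thesis
    by (simp only: sum_Stirling_Suc sum_divide_distrib times_divide_eq_right)
qed

text \<open>Here \<open>G j\<close> plays the part of \<open>(x D)\<^sup>j f\<close> at \<open>x = t\<^sup>\<alpha>\<close>, so that \<open>\<alpha>\<^sup>j G j\<close> is \<open>(t d/dt)\<^sup>j\<close>
  applied to the composite function, and the sum divided by \<open>t\<^sup>d\<close> is its \<open>d\<close>-th derivative.\<close>

lemma derivative_from_euler_operator_powers:
  fixes G :: "nat \<Rightarrow> real \<Rightarrow> real"
  assumes G: "\<And>j. (G j has_field_derivative \<alpha> * G (Suc j) t / t) (at t)" and t: "t \<noteq> 0"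
  shows "((\<lambda>t. (\<Sum>j\<le>d. real_of_int (signed_stirling d j) * (\<alpha> ^ j * G j t)) / t ^ d)
    has_field_derivative
      (\<Sum>j\<le>Suc d. real_of_int (signed_stirling (Suc d) j) * (\<alpha> ^ j * G j t)) / t ^ Suc d) (at t)"
proof -
  have "((\<lambda>t. (\<alpha> ^ j * G j t) / t ^ d) has_field_derivative
      (\<alpha> ^ Suc j * G (Suc j) t - real d * (\<alpha> ^ j * G j t)) / t ^ Suc d) (at t)" for j
    by (rule derivative_eq_intros G refl)+ (use t in \<open>cases d; simp add: field_simps\<close>)+
  from DERIV_sum [OF DERIV_cmult [OF this]]
  have "((\<lambda>t. \<Sum>j\<le>d. real_of_int (signed_stirling d j) * ((\<alpha> ^ j * G j t) / t ^ d))
      has_field_derivative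
      (\<Sum>j\<le>d. real_of_int (signed_stirling d j) *
        ((\<alpha> ^ Suc j * G (Suc j) t - real d * (\<alpha> ^ j * G j t)) / t ^ Suc d))) (at t)" .
  then show ?thesis
    by (simp only: sum_signed_stirling_Suc sum_divide_distrib times_divide_eq_right)
qed

text \<open>Both sides satisfy the recurrence of the Stirling numbers in \<open>n\<close>; for the right-hand side
  this is the absorption identity
  \<open>i (k choose i) = k (k choose i) - k ((k-1) choose i)\<close>.\<close>

lemma fact_mult_Stirling:
  "fact k * real (Stirling n k) =
    (\<Sum>i\<le>k. (-1) ^ (k + i) * real (k choose i) * real i ^ n)"
proof (induction n arbitrary: k)
  case 0
  show ?case
  proof (cases k)
    case (Suc m)
    have "(\<Sum>i\<le>k. (-1) ^ (k + i) * real (k choose i) * real i ^ 0) =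
        (-1) ^ k * (\<Sum>i\<le>k. (-1) ^ i * real (k choose i))"
      by (simp add: power_add mult.assoc sum_distrib_left)
    also have "\<dots> = 0"
      by (subst choose_alternating_sum) (use Suc in simp_all)
    finally have "(\<Sum>i\<le>k. (-1) ^ (k + i) * real (k choose i) * real i ^ 0) = 0" .
    moreover have "Stirling 0 k = 0"
      using Suc by simp
    ultimately show ?thesis
      by simp
  qed simp
next
  case (Suc n)
  note IH = Suc.IH
  show ?case
  proof (cases k)
    case (Suc m)
    have sign: "(-1) ^ (k + i) = (- ((-1) ^ (m + i)) :: real)" for i
      using Suc by simp
    have absorb: "real i * real (k choose i) = real k * (real (k choose i) - real (m choose i))"
      if "i \<le> k" for i
    proof -
      have "real (k - i) * real (k choose i) = real k * real (m choose i)"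
        using binomial_absorb_comp [of k i]
        unfolding of_nat_mult [symmetric] of_nat_eq_iff by (simp add: Suc)
      then show ?thesis
        using that by (simp add: of_nat_diff algebra_simps)
    qed
    have "(\<Sum>i\<le>k. (-1) ^ (k + i) * real (k choose i) * real i ^ Suc n) =
        (\<Sum>i\<le>k. (-1) ^ (k + i) * (real i * real (k choose i)) * real i ^ n)"
      by (simp add: mult_ac)
    also have "\<dots> = (\<Sum>i\<le>k. real k * ((-1) ^ (k + i) * real (k choose i) * real i ^ n) +
        real k * ((-1) ^ (m + i) * real (m choose i) * real i ^ n))"
    proof (rule sum.cong [OF refl])
      fix i assume "i \<in> {..k}"
      then have "i \<le> k"
        by simp
      then show "(-1) ^ (k + i) * (real i * real (k choose i)) * real i ^ n =
          real k * ((-1) ^ (k + i) * real (k choose i) * real i ^ n) +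
          real k * ((-1) ^ (m + i) * real (m choose i) * real i ^ n)"
        unfolding absorb [OF \<open>i \<le> k\<close>] sign by (simp add: algebra_simps)
    qed
    also have "\<dots> = real k * (\<Sum>i\<le>k. (-1) ^ (k + i) * real (k choose i) * real i ^ n) +
        real k * (\<Sum>i\<le>k. (-1) ^ (m + i) * real (m choose i) * real i ^ n)"
      by (simp only: sum.distrib sum_distrib_left)
    also have "(\<Sum>i\<le>k. (-1) ^ (k + i) * real (k choose i) * real i ^ n) =
        fact k * real (Stirling n k)"
      by (rule IH [symmetric])
    also have "(\<Sum>i\<le>k. (-1) ^ (m + i) * real (m choose i) * real i ^ n) =
        fact m * real (Stirling n m)"
      unfolding IH Suc by simp
    also have "real k * (fact k * real (Stirling n k)) + real k * (fact m * real (Stirling n m)) =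
        fact k * real (Stirling (Suc n) k)"
      unfolding Suc by (simp add: algebra_simps)
    finally show ?thesis ..
  qed simp
qed

section \<open>Falling factorials\<close>

lemma falling_fact_pochhammer: "falling_fact (real n - 1 + a) n = pochhammer a n"
proof -
  have "falling_fact (real n - 1 + a) n = (\<Prod>i<n. a + real (n - Suc i))"
    unfolding falling_fact_def by (rule prod.cong) (auto simp: of_nat_diff)
  also have "\<dots> = (\<Prod>i<n. a + real i)"
    by (rule prod.nat_diff_reindex)
  finally show ?thesis
    by (simp add: pochhammer_prod lessThan_atLeast0)
qed

lemma falling_fact_Suc: "falling_fact x (Suc n) = falling_fact x n * (x - real n)"
  by (simp add: falling_fact_def)

text \<open>This puts the derivatives of \<open>1 - (1-u)\<^sup>x\<close> in the form with the factor \<open>x\<close> split off and only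
  positive factors left when \<open>0 < x < 1\<close>.\<close>

lemma falling_fact_Suc_pochhammer:
  "(-1) ^ n * falling_fact x (Suc n) = x * pochhammer (1 - x) n"
proof (induction n)
  case (Suc n)
  have "(-1) ^ Suc n * falling_fact x (Suc (Suc n)) =
      ((-1) ^ n * falling_fact x (Suc n)) * (real (Suc n) - x)"
    by (simp only: falling_fact_Suc [of x "Suc n"] power_Suc) (simp add: algebra_simps)
  also have "\<dots> = x * pochhammer (1 - x) (Suc n)"
    by (simp only: Suc.IH pochhammer_rec') (simp add: algebra_simps)
  finally show ?case .
qed (simp add: falling_fact_def)

section \<open>Ali-Mikhail-Haq, Clayton and Frank\<close>

lemma derivatives_psi_AMH:
  assumes "0 < \<theta>" "\<theta> < 1" "0 < t"
  shows "times_differentiable_at d (psi_AMH \<theta>) t"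
    and "(-1) ^ d * (deriv ^^ d) (psi_AMH \<theta>) t =
      (1 - \<theta>) / \<theta> * polylog (- real d) (\<theta> * exp (- t))"
proof -
  define g where "g d t = (1 - \<theta>) / \<theta> * polylog (- real d) (\<theta> * exp (- t))" for d t
  have g0: "psi_AMH \<theta> t = g 0 t" if "t \<in> {0<..}" for t
  proof -
    have "exp (- t) < 1" "exp t > 1"
      using that by auto
    moreover have "\<theta> * exp (- t) < 1 * 1"
      using assms that by (intro mult_strict_mono) auto
    ultimately show ?thesis
      using assms by (simp add: g_def psi_AMH_def polylog_0 exp_minus field_simps)
  qed
  have g: "(g d has_field_derivative - g (Suc d) t) (at t)" if "t \<in> {0<..}" for d t
  proof -
    have "- real (Suc d) = - real d - 1"
      by simp
    then show ?thesis
      using DERIV_cmult [OF has_field_derivative_polylog_exp [of \<theta> t "- real d"],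
          of "(1 - \<theta>) / \<theta>"] assms that
      by (simp only: g_def [abs_def]) simp
  qed
  have t: "t \<in> {0<..}"
    using assms by simp
  show "times_differentiable_at d (psi_AMH \<theta>) t"
    by (rule iterated_deriv_of_derivative_sequence [where g = g, OF open_greaterThan g0 g t])
  show "(-1) ^ d * (deriv ^^ d) (psi_AMH \<theta>) t =
      (1 - \<theta>) / \<theta> * polylog (- real d) (\<theta> * exp (- t))"
    unfolding g_def [symmetric]
    by (rule iterated_deriv_of_derivative_sequence [where g = g, OF open_greaterThan g0 g t])
qed

lemma derivatives_psi_AMH_0:
  shows "times_differentiable_at d (psi_AMH 0) t"
    and "(-1) ^ d * (deriv ^^ d) (psi_AMH 0) t = exp (- t)"
proof -
  have g0: "psi_AMH 0 t = exp (- t)" for t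
    by (simp add: psi_AMH_def exp_minus inverse_eq_divide)
  have g: "((\<lambda>t. exp (- t)) has_field_derivative - exp (- t)) (at t)" for t :: real
    by (auto intro!: derivative_eq_intros)
  show "times_differentiable_at d (psi_AMH 0) t"
    by (rule iterated_deriv_of_derivative_sequence [where g = "\<lambda>_ t. exp (- t)", OF open_UNIV g0 g UNIV_I])
  show "(-1) ^ d * (deriv ^^ d) (psi_AMH 0) t = exp (- t)"
    by (rule iterated_deriv_of_derivative_sequence [where g = "\<lambda>_ t. exp (- t)", OF open_UNIV g0 g UNIV_I])
qed

lemma AMH_formula_tendsto:
  "((\<lambda>\<theta>. (1 - \<theta>) / \<theta> * polylog s (\<theta> * exp (- t))) \<longlongrightarrow> exp (- t)) (at_right 0)"
proof -
  define q where "q = exp (- t)"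
  have q: "q > 0"
    by (simp add: q_def)
  have "filterlim (\<lambda>\<theta>. \<theta> * q) (at 0) (at_right 0)"
    unfolding filterlim_at
  proof
    show "((\<lambda>\<theta>. \<theta> * q) \<longlongrightarrow> 0) (at_right 0)"
      by (auto intro!: tendsto_eq_intros)
    show "\<forall>\<^sub>F \<theta> in at_right 0. \<theta> * q \<in> UNIV \<and> \<theta> * q \<noteq> 0"
      using q by (auto simp: eventually_at_filter)
  qed
  from filterlim_compose [OF polylog_over_argument_tendsto this, of s]
  have "((\<lambda>\<theta>. (1 - \<theta>) * q * (polylog s (\<theta> * q) / (\<theta> * q))) \<longlongrightarrow> (1 - 0) * q * 1) (at_right 0)"
    by (intro tendsto_intros)
  then show ?thesis
    using q by (simp add: q_def)
qed

lemma derivatives_psi_Clayton: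
  assumes "0 < t"
  shows "times_differentiable_at d (psi_Clayton \<theta>) t"
    and "(-1) ^ d * (deriv ^^ d) (psi_Clayton \<theta>) t =
      pochhammer (1 / \<theta>) d * (1 + t) powr (- (real d + 1 / \<theta>))"
proof -
  define g where "g d t = pochhammer (1 / \<theta>) d * (1 + t) powr (- (real d + 1 / \<theta>))" for d t
  have g0: "psi_Clayton \<theta> t = g 0 t" for t
    by (simp add: g_def psi_Clayton_def)
  have g: "(g d has_field_derivative - g (Suc d) t) (at t)" if "t \<in> {0<..}" for d t
  proof -
    define b where "b = - (real d + 1 / \<theta>)"
    have b: "- (real (Suc d) + 1 / \<theta>) = b - 1" "real d + 1 / \<theta> = - b"
      by (simp_all add: b_def)
    have "((\<lambda>t. 1 + t) has_field_derivative 1) (at t)"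
      by (auto intro!: derivative_eq_intros)
    from DERIV_chain2 [OF has_real_derivative_powr [of "1 + t" b] this]
    have "((\<lambda>t. (1 + t) powr b) has_field_derivative b * (1 + t) powr (b - 1)) (at t)"
      using that by simp
    from DERIV_cmult [OF this, of "pochhammer (1 / \<theta>) d"] show ?thesis
      unfolding g_def [abs_def] b b_def [symmetric] pochhammer_rec'
      by (simp add: b algebra_simps)
  qed
  have t: "t \<in> {0<..}"
    using assms by simp
  show "times_differentiable_at d (psi_Clayton \<theta>) t"
    by (rule iterated_deriv_of_derivative_sequence [where g = g, OF open_greaterThan g0 g t])
  show "(-1) ^ d * (deriv ^^ d) (psi_Clayton \<theta>) t =
      pochhammer (1 / \<theta>) d * (1 + t) powr (- (real d + 1 / \<theta>))"
    unfolding g_def [symmetric]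
    by (rule iterated_deriv_of_derivative_sequence [where g = g, OF open_greaterThan g0 g t])
qed

lemma derivatives_psi_Frank:
  assumes "0 < \<theta>" "0 < t"
  shows "times_differentiable_at d (psi_Frank \<theta>) t"
    and "(-1) ^ d * (deriv ^^ d) (psi_Frank \<theta>) t =
      1 / \<theta> * polylog (- (real d - 1)) ((1 - exp (- \<theta>)) * exp (- t))"
proof -
  define c where "c = 1 - exp (- \<theta>)"
  have c: "0 < c" "c < 1"
    using assms by (simp_all add: c_def)
  define g where "g d t = 1 / \<theta> * polylog (- (real d - 1)) (c * exp (- t))" for d t
  have g0: "psi_Frank \<theta> t = g 0 t" if "t \<in> {0<..}" for t
  proof -
    have "c * exp (- t) < 1 * 1"
      using c that by (intro mult_strict_mono) auto
    then show ?thesis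
      using c by (simp add: g_def psi_Frank_def polylog_1 flip: c_def)
  qed
  have g: "(g d has_field_derivative - g (Suc d) t) (at t)" if "t \<in> {0<..}" for d t
    using DERIV_cmult [OF has_field_derivative_polylog_exp [of c t "- (real d - 1)"], of "1 / \<theta>"]
      c that by (simp add: g_def [abs_def])
  have t: "t \<in> {0<..}"
    using assms by simp
  show "times_differentiable_at d (psi_Frank \<theta>) t"
    by (rule iterated_deriv_of_derivative_sequence [where g = g, OF open_greaterThan g0 g t])
  show "(-1) ^ d * (deriv ^^ d) (psi_Frank \<theta>) t =
      1 / \<theta> * polylog (- (real d - 1)) ((1 - exp (- \<theta>)) * exp (- t))"
    unfolding g_def [symmetric] c_def [symmetric]
    by (rule iterated_deriv_of_derivative_sequence [where g = g, OF open_greaterThan g0 g t])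
qed

section \<open>Gumbel\<close>

lemma a_Gumbel_signed_sum:
  assumes "k \<le> d"
  shows "a_Gumbel d k \<theta> = (-1) ^ (d + k) *
    (\<Sum>j\<le>d. real_of_int (signed_stirling d j) * ((1 / \<theta>) ^ j * real (Stirling j k)))"
proof -
  have "(\<Sum>j\<le>d. real_of_int (signed_stirling d j) * ((1 / \<theta>) ^ j * real (Stirling j k))) =
      (\<Sum>j=k..d. real_of_int (signed_stirling d j) * ((1 / \<theta>) ^ j * real (Stirling j k)))"
    by (rule sum.mono_neutral_right) auto
  moreover have "\<theta> powi (- int j) = (1 / \<theta>) ^ j" for j
    by (simp add: power_int_minus power_divide inverse_eq_divide)
  moreover have "(-1) ^ (d - k) = ((-1) ^ (d + k) :: real)"
    using assms by (simp add: minus_one_power_iff)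
  ultimately show ?thesis
    by (simp only: a_Gumbel_def) (simp add: mult_ac)
qed

lemma a_Gumbel_0:
  assumes "1 \<le> d"
  shows "a_Gumbel d 0 \<theta> = 0"
proof -
  have "real_of_int (signed_stirling d j) * ((1 / \<theta>) ^ j * real (Stirling j 0)) = 0" for j
    using assms by (cases j; cases d) auto
  then have "(\<Sum>j\<le>d. real_of_int (signed_stirling d j) * ((1 / \<theta>) ^ j * real (Stirling j 0))) = 0"
    by (intro sum.neutral ballI)
  then show ?thesis
    by (simp only: a_Gumbel_signed_sum [OF le0] mult_zero_right)
qed

lemma a_Gumbel_closed_form:
  assumes "1 \<le> k" "k \<le> d"
  shows "a_Gumbel d k \<theta> = fact d / fact k *
    (\<Sum>j=1..k. real (k choose j) * ((1 / \<theta> * real j) gchoose d) * (-1) ^ (d - j))"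
proof -
  define \<alpha> where "\<alpha> = 1 / \<theta>"
  have "fact k * a_Gumbel d k \<theta> = (-1) ^ (d + k) *
      (\<Sum>j\<le>d. real_of_int (signed_stirling d j) * (\<alpha> ^ j * (fact k * real (Stirling j k))))"
    using assms by (simp add: a_Gumbel_signed_sum \<alpha>_def sum_distrib_left mult_ac)
  also have "\<dots> = (\<Sum>j\<le>d. \<Sum>i\<le>k. (-1) ^ (d + k) * (real_of_int (signed_stirling d j) *
      (\<alpha> ^ j * ((-1) ^ (k + i) * real (k choose i) * real i ^ j))))"
    by (simp only: fact_mult_Stirling sum_distrib_left)
  also have "\<dots> = (\<Sum>i\<le>k. \<Sum>j\<le>d. (-1) ^ (d + k) * (real_of_int (signed_stirling d j) *
      (\<alpha> ^ j * ((-1) ^ (k + i) * real (k choose i) * real i ^ j))))"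
    by (rule sum.swap)
  also have "\<dots> = (\<Sum>i\<le>k. (-1) ^ (d + i) * real (k choose i) * falling_fact (\<alpha> * real i) d)"
  proof (rule sum.cong [OF refl])
    fix i
    have sign: "(-1) ^ (d + k) * (-1) ^ (k + i) = ((-1) ^ (d + i) :: real)"
      by (simp add: minus_one_power_iff)
    show "(\<Sum>j\<le>d. (-1) ^ (d + k) * (real_of_int (signed_stirling d j) *
        (\<alpha> ^ j * ((-1) ^ (k + i) * real (k choose i) * real i ^ j)))) =
        (-1) ^ (d + i) * real (k choose i) * falling_fact (\<alpha> * real i) d"
      unfolding sign [symmetric] falling_fact_signed_stirling sum_distrib_left
      by (simp add: power_mult_distrib mult_ac)
  qed
  \<comment> \<open>The term \<open>i = 0\<close> vanishes because \<open>0\<close> is a factor of its falling factorial.\<close>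
  also have "\<dots> = (\<Sum>i=1..k. (-1) ^ (d + i) * real (k choose i) * falling_fact (\<alpha> * real i) d)"
    using assms by (intro sum.mono_neutral_right) (auto simp: falling_fact_def not_le)
  also have "\<dots> = fact d *
      (\<Sum>i=1..k. real (k choose i) * ((\<alpha> * real i) gchoose d) * (-1) ^ (d - i))"
    unfolding sum_distrib_left
    by (rule sum.cong) (use assms in \<open>auto simp: gchoose_falling_fact minus_one_power_iff\<close>)
  finally show ?thesis
    by (simp add: \<alpha>_def field_simps)
qed

lemma derivatives_psi_Gumbel:
  assumes "1 \<le> d" "0 < t"
  shows "times_differentiable_at d (psi_Gumbel \<theta>) t"
    and "(-1) ^ d * (deriv ^^ d) (psi_Gumbel \<theta>) t =
      psi_Gumbel \<theta> t / t ^ d * P_Gumbel d \<theta> (t powr (1 / \<theta>))"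
proof -
  define \<alpha> where "\<alpha> = 1 / \<theta>"
  \<comment> \<open>\<open>F k\<close> is the \<open>k\<close>-th derivative of \<open>exp (-x)\<close>, \<open>E j\<close> is \<open>(x d/dx)\<^sup>j\<close> applied to it, and \<open>H d\<close> is
    the \<open>d\<close>-th derivative of the generator.\<close>
  define F :: "nat \<Rightarrow> real \<Rightarrow> real" where "F k x = (-1) ^ k * exp (- x)" for k x
  define E where "E j x = (\<Sum>k\<le>j. real (Stirling j k) * (x ^ k * F k x))" for j x
  define G where "G j t = E j (t powr \<alpha>)" for j t
  define H where "H d t = (\<Sum>j\<le>d. real_of_int (signed_stirling d j) * (\<alpha> ^ j * G j t)) / t ^ d"
    for d t
  have F: "(F k has_field_derivative F (Suc k) x) (at x)" for k x
    unfolding F_def [abs_def] by (auto intro!: derivative_eq_intros)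
  have E: "(E j has_field_derivative E (Suc j) x / x) (at x)" if "x \<noteq> 0" for j x
    unfolding E_def [abs_def] by (rule euler_operator_power [where F = F, OF F that])
  have G: "(G j has_field_derivative \<alpha> * G (Suc j) t / t) (at t)" if "t > 0" for j t
  proof -
    have "((\<lambda>t. t powr \<alpha>) has_field_derivative \<alpha> * t powr \<alpha> / t) (at t)"
      using has_real_derivative_powr [OF that, of \<alpha>] that by (simp add: powr_diff)
    from DERIV_chain2 [OF E this, of j] show ?thesis
      using that unfolding G_def [abs_def] by (simp add: field_simps)
  qed
  have H: "(H d has_field_derivative H (Suc d) t) (at t)" if "t > 0" for d t
    unfolding H_def [abs_def]
    by (rule derivative_from_euler_operator_powers [where G = G, OF G]) (use that in auto)
  define g where "g d t = (-1) ^ d * H d t" for d t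
  have g0: "psi_Gumbel \<theta> t = g 0 t" for t
    by (simp add: g_def H_def G_def E_def F_def signed_stirling_def psi_Gumbel_def \<alpha>_def)
  have g: "(g d has_field_derivative - g (Suc d) t) (at t)" if "t \<in> {0<..}" for d t
    using DERIV_cmult [OF H [of t d], of "(-1) ^ d"] that by (simp add: g_def [abs_def])
  have t: "t \<in> {0<..}"
    using assms by simp
  show "times_differentiable_at d (psi_Gumbel \<theta>) t"
    by (rule iterated_deriv_of_derivative_sequence [where g = g, OF open_greaterThan g0 g t])
  have "(-1) ^ d * (deriv ^^ d) (psi_Gumbel \<theta>) t = g d t"
    by (rule iterated_deriv_of_derivative_sequence [where g = g, OF open_greaterThan g0 g t])
  also have "g d t = psi_Gumbel \<theta> t / t ^ d * P_Gumbel d \<theta> (t powr (1 / \<theta>))"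
  proof -
    define x where "x = t powr \<alpha>"
    \<comment> \<open>Since \<open>S(j,k) = 0\<close> for \<open>k > j\<close>, the inner sums may all run up to \<open>d\<close>, and the order of
      summation can be exchanged.\<close>
    have E': "E j x = (\<Sum>k\<le>d. real (Stirling j k) * (x ^ k * F k x))" if "j \<le> d" for j
      unfolding E_def by (rule sum.mono_neutral_left) (use that in auto)
    have "(-1) ^ d * (\<Sum>j\<le>d. real_of_int (signed_stirling d j) * (\<alpha> ^ j * E j x)) =
        (\<Sum>j\<le>d. \<Sum>k\<le>d. (-1) ^ d * (real_of_int (signed_stirling d j) *
          (\<alpha> ^ j * (real (Stirling j k) * (x ^ k * F k x)))))"
      by (simp add: E' sum_distrib_left)
    also have "\<dots> = (\<Sum>k\<le>d. \<Sum>j\<le>d. (-1) ^ d * (real_of_int (signed_stirling d j) *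
          (\<alpha> ^ j * (real (Stirling j k) * (x ^ k * F k x)))))"
      by (rule sum.swap)
    also have "\<dots> = (\<Sum>k\<le>d. exp (- x) * (a_Gumbel d k \<theta> * x ^ k))"
      by (rule sum.cong)
         (simp_all add: a_Gumbel_signed_sum F_def \<alpha>_def sum_distrib_left sum_distrib_right
            power_add mult_ac)
    also have "\<dots> = (\<Sum>k=1..d. exp (- x) * (a_Gumbel d k \<theta> * x ^ k))"
      by (rule sum.mono_neutral_right) (use assms in \<open>auto simp: a_Gumbel_0 not_le\<close>)
    also have "\<dots> = exp (- x) * P_Gumbel d \<theta> x"
      by (simp add: P_Gumbel_def sum_distrib_left)
    finally show ?thesis
      by (simp add: g_def H_def G_def psi_Gumbel_def \<alpha>_def x_def)
  qed
  finally show "(-1) ^ d * (deriv ^^ d) (psi_Gumbel \<theta>) t =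
      psi_Gumbel \<theta> t / t ^ d * P_Gumbel d \<theta> (t powr (1 / \<theta>))" .
qed

section \<open>Joe\<close>

lemma a_Joe_pochhammer:
  assumes "1 \<le> k"
  shows "a_Joe d k \<theta> = real (Stirling d k) * pochhammer (1 - 1 / \<theta>) (k - 1)"
proof -
  have "real k - 1 - 1 / \<theta> = real (k - 1) - 1 + (1 - 1 / \<theta>)"
    using assms by (simp add: of_nat_diff)
  then show ?thesis
    by (simp only: a_Joe_def falling_fact_pochhammer)
qed

lemma a_Joe_Gamma:
  assumes "1 < \<theta>" "1 \<le> k"
  shows "a_Joe d k \<theta> =
    real (Stirling d k) * (Gamma (real k - 1 / \<theta>) / Gamma (1 - 1 / \<theta>))"
proof -
  have "1 - 1 / \<theta> \<notin> \<int>\<^sub>\<le>\<^sub>0"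
    using assms by (auto dest!: nonpos_Ints_nonpos simp: field_simps)
  then have "pochhammer (1 - 1 / \<theta>) (k - 1) = Gamma (1 - 1 / \<theta> + real (k - 1)) / Gamma (1 - 1 / \<theta>)"
    by (rule pochhammer_Gamma)
  moreover have "1 - 1 / \<theta> + real (k - 1) = real k - 1 / \<theta>"
    using assms by (simp add: of_nat_diff)
  ultimately show ?thesis
    using assms by (simp add: a_Joe_pochhammer)
qed

text \<open>To the right of \<open>1\<close> the quotient of Gamma values is \<open>a_Joe d k\<close> itself, which is continuous
  in \<open>\<theta>\<close> even though \<open>\<Gamma>(1 - 1/\<theta>)\<close> has a pole at \<open>\<theta> = 1\<close>.\<close>

lemma a_Joe_Gamma_tendsto:
  assumes "1 \<le> k"
  shows "((\<lambda>\<theta>. real (Stirling d k) * (Gamma (real k - 1 / \<theta>) / Gamma (1 - 1 / \<theta>)))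
    \<longlongrightarrow> a_Joe d k 1) (at_right 1)"
proof (rule Lim_transform_eventually)
  show "(a_Joe d k \<longlongrightarrow> a_Joe d k 1) (at_right 1)"
    unfolding a_Joe_def [abs_def] falling_fact_def by (intro tendsto_intros) auto
  show "\<forall>\<^sub>F \<theta> in at_right 1. a_Joe d k \<theta> =
      real (Stirling d k) * (Gamma (real k - 1 / \<theta>) / Gamma (1 - 1 / \<theta>))"
    using assms by (auto simp: eventually_at_filter a_Joe_Gamma)
qed

lemma derivatives_psi_Joe:
  assumes "1 \<le> d" "0 < t"
  shows "times_differentiable_at d (psi_Joe \<theta>) t"
    and "(-1) ^ d * (deriv ^^ d) (psi_Joe \<theta>) t =
      exp (- t) / (\<theta> * (1 - exp (- t)) powr (1 - 1 / \<theta>))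
        * P_Joe d \<theta> (exp (- t) / (1 - exp (- t)))"
proof -
  define \<alpha> where "\<alpha> = 1 / \<theta>"
  \<comment> \<open>\<open>F k\<close> is the \<open>k\<close>-th derivative of \<open>1 - (1-u)\<^sup>\<alpha>\<close>; its constant \<open>1\<close> survives only for \<open>k = 0\<close>.\<close>
  define F :: "nat \<Rightarrow> real \<Rightarrow> real" where
    "F k u = (if k = 0 then 1 else 0) - (-1) ^ k * falling_fact \<alpha> k * (1 - u) powr (\<alpha> - real k)"
    for k u
  define E where "E j u = (\<Sum>k\<le>j. real (Stirling j k) * (u ^ k * F k u))" for j u
  define g where "g d t = E d (exp (- t))" for d t
  have F: "(F k has_field_derivative F (Suc k) u) (at u)" if "u < 1" for k u
  proof -
    have b: "\<alpha> - real (Suc k) = (\<alpha> - real k) - 1"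
      by simp
    have "((\<lambda>u. 1 - u) has_field_derivative -1) (at u)"
      by (auto intro!: derivative_eq_intros)
    from DERIV_chain2 [OF has_real_derivative_powr [of "1 - u" "\<alpha> - real k"] this]
    have "((\<lambda>u. (1 - u) powr (\<alpha> - real k)) has_field_derivative
        - ((\<alpha> - real k) * (1 - u) powr (\<alpha> - real k - 1))) (at u)"
      using that by simp
    from DERIV_diff [OF DERIV_const DERIV_cmult [OF this, of "(-1) ^ k * falling_fact \<alpha> k"]]
    show ?thesis
      unfolding F_def [abs_def] b falling_fact_Suc by (simp add: algebra_simps)
  qed
  have E: "(E j has_field_derivative E (Suc j) u / u) (at u)" if "u < 1" "u \<noteq> 0" for j u
    unfolding E_def [abs_def] by (rule euler_operator_power [where F = F, OF F that(2)]) (rule that(1))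
  have g0: "psi_Joe \<theta> t = g 0 t" for t
    by (simp add: g_def E_def F_def psi_Joe_def falling_fact_def \<alpha>_def)
  have g: "(g d has_field_derivative - g (Suc d) t) (at t)" if "t \<in> {0<..}" for d t
  proof -
    have "((\<lambda>t. exp (- t)) has_field_derivative - exp (- t)) (at t)"
      by (auto intro!: derivative_eq_intros)
    from DERIV_chain2 [OF E this, of d] show ?thesis
      using that by (simp add: g_def [abs_def])
  qed
  have t: "t \<in> {0<..}"
    using assms by simp
  show "times_differentiable_at d (psi_Joe \<theta>) t"
    by (rule iterated_deriv_of_derivative_sequence [where g = g, OF open_greaterThan g0 g t])
  have "(-1) ^ d * (deriv ^^ d) (psi_Joe \<theta>) t = g d t"
    by (rule iterated_deriv_of_derivative_sequence [where g = g, OF open_greaterThan g0 g t])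
  also have "g d t = exp (- t) / (\<theta> * (1 - exp (- t)) powr (1 - 1 / \<theta>))
      * P_Joe d \<theta> (exp (- t) / (1 - exp (- t)))"
  proof -
    define u where "u = exp (- t)"
    have u: "0 < u" "u < 1"
      using assms by (simp_all add: u_def)
    have summand: "real (Stirling d k) * (u ^ k * F k u) =
        u / (\<theta> * (1 - u) powr (1 - \<alpha>)) * (a_Joe d k \<theta> * (u / (1 - u)) ^ (k - 1))"
      if k1: "1 \<le> k" for k
    proof -
      obtain m where k: "k = Suc m"
        using k1 by (cases k) auto
      have F': "F k u = \<alpha> * pochhammer (1 - \<alpha>) m * (1 - u) powr (\<alpha> - real k)"
        using falling_fact_Suc_pochhammer [of m \<alpha>] by (simp add: F_def k)
      have pow: "(1 - u) powr (\<alpha> - real k) = 1 / (1 - u) powr (1 - \<alpha>) / (1 - u) ^ m"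
        using u by (simp add: k powr_diff powr_add powr_realpow field_simps)
      show ?thesis
        unfolding F' pow a_Joe_pochhammer [OF k1]
        by (simp add: k \<alpha>_def power_divide mult_ac)
    qed
    \<comment> \<open>For \<open>d \<ge> 1\<close> the coefficient \<open>S(d,0)\<close> is zero, which removes that exceptional \<open>F 0\<close>.\<close>
    have "E d u = (\<Sum>k=1..d. real (Stirling d k) * (u ^ k * F k u))"
      unfolding E_def
    proof (rule sum.mono_neutral_right)
      show "\<forall>k\<in>{..d} - {1..d}. real (Stirling d k) * (u ^ k * F k u) = 0"
        using assms by (cases d) (auto simp: not_le)
    qed auto
    also have "\<dots> = u / (\<theta> * (1 - u) powr (1 - \<alpha>)) * P_Joe d \<theta> (u / (1 - u))"
      unfolding P_Joe_def sum_distrib_left by (rule sum.cong) (auto simp: summand)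
    finally show ?thesis
      by (simp add: g_def u_def \<alpha>_def)
  qed
  finally show "(-1) ^ d * (deriv ^^ d) (psi_Joe \<theta>) t =
      exp (- t) / (\<theta> * (1 - exp (- t)) powr (1 - 1 / \<theta>))
        * P_Joe d \<theta> (exp (- t) / (1 - exp (- t)))" .
qed

section \<open>The five families\<close>

theorem theorem3p2:
  shows
    "(\<forall>\<theta>::real. 0 \<le> \<theta> \<and> \<theta> < 1 \<longrightarrow> (\<forall>t>0. \<forall>d::nat.
       times_differentiable_at d (psi_AMH \<theta>) t \<and>
       (\<theta> > 0 \<longrightarrow>
          (-1) ^ d * (deriv ^^ d) (psi_AMH \<theta>) t
            = (1 - \<theta>) / \<theta> * polylog (- real d) (\<theta> * exp (- t))) \<and>
       (\<theta> = 0 \<longrightarrow>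
          ((\<lambda>\<theta>'. (1 - \<theta>') / \<theta>' * polylog (- real d) (\<theta>' * exp (- t)))
            \<longlongrightarrow> (-1) ^ d * (deriv ^^ d) (psi_AMH \<theta>) t) (at_right 0)))) \<and>
     (\<forall>\<theta>::real. \<theta> > 0 \<longrightarrow> (\<forall>t>0. \<forall>d::nat.
       times_differentiable_at d (psi_Clayton \<theta>) t \<and>
       (-1) ^ d * (deriv ^^ d) (psi_Clayton \<theta>) t
         = falling_fact (real d - 1 + 1 / \<theta>) d * (1 + t) powr (- (real d + 1 / \<theta>)) \<and>
       falling_fact (real d - 1 + 1 / \<theta>) d = (\<Prod>k<d. real k + 1 / \<theta>) \<and>
       (\<Prod>k<d. real k + 1 / \<theta>) = Gamma (real d + 1 / \<theta>) / Gamma (1 / \<theta>))) \<and>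
     (\<forall>\<theta>::real. \<theta> > 0 \<longrightarrow> (\<forall>t>0. \<forall>d::nat.
       times_differentiable_at d (psi_Frank \<theta>) t \<and>
       (-1) ^ d * (deriv ^^ d) (psi_Frank \<theta>) t
         = 1 / \<theta> * polylog (- (real d - 1)) ((1 - exp (- \<theta>)) * exp (- t)))) \<and>
     (\<forall>\<theta>::real. \<theta> \<ge> 1 \<longrightarrow> (\<forall>d::nat. d \<ge> 1 \<longrightarrow>
       (\<forall>t>0. times_differentiable_at d (psi_Gumbel \<theta>) t \<and>
          (-1) ^ d * (deriv ^^ d) (psi_Gumbel \<theta>) t
            = psi_Gumbel \<theta> t / t ^ d * P_Gumbel d \<theta> (t powr (1 / \<theta>))) \<and>
       (\<forall>k\<in>{1..d}. a_Gumbel d k \<theta>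
          = fact d / fact k *
            (\<Sum>j=1..k. real (k choose j) * ((1 / \<theta> * real j) gchoose d) * (-1) ^ (d - j))))) \<and>
     (\<forall>\<theta>::real. \<theta> \<ge> 1 \<longrightarrow> (\<forall>d::nat. d \<ge> 1 \<longrightarrow>
       (\<forall>t>0. times_differentiable_at d (psi_Joe \<theta>) t \<and>
          (-1) ^ d * (deriv ^^ d) (psi_Joe \<theta>) t
            = exp (- t) / (\<theta> * (1 - exp (- t)) powr (1 - 1 / \<theta>))
              * P_Joe d \<theta> (exp (- t) / (1 - exp (- t)))) \<and>
       (\<forall>k\<in>{1..d}.
          (\<theta> > 1 \<longrightarrow>
             a_Joe d k \<theta> = real (Stirling d k) * (Gamma (real k - 1 / \<theta>) / Gamma (1 - 1 / \<theta>))) \<and>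
          (\<theta> = 1 \<longrightarrow>
             ((\<lambda>\<theta>'. real (Stirling d k) * (Gamma (real k - 1 / \<theta>') / Gamma (1 - 1 / \<theta>')))
               \<longlongrightarrow> a_Joe d k \<theta>) (at_right 1)))))"
proof (intro conjI allI impI ballI)
  fix \<theta> t :: real and d :: nat
  assume \<theta>: "0 \<le> \<theta> \<and> \<theta> < 1" and t: "0 < t"
  show "times_differentiable_at d (psi_AMH \<theta>) t"
    using \<theta> t derivatives_psi_AMH(1) derivatives_psi_AMH_0(1) by (cases "\<theta> = 0") auto
  show "(-1) ^ d * (deriv ^^ d) (psi_AMH \<theta>) t
      = (1 - \<theta>) / \<theta> * polylog (- real d) (\<theta> * exp (- t))" if "\<theta> > 0"
    using \<theta> t that by (intro derivatives_psi_AMH(2)) auto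
  show "((\<lambda>\<theta>'. (1 - \<theta>') / \<theta>' * polylog (- real d) (\<theta>' * exp (- t)))
      \<longlongrightarrow> (-1) ^ d * (deriv ^^ d) (psi_AMH \<theta>) t) (at_right 0)" if "\<theta> = 0"
    unfolding that derivatives_psi_AMH_0(2) by (rule AMH_formula_tendsto)
next
  fix \<theta> t :: real and d :: nat
  assume \<theta>: "\<theta> > 0" and t: "0 < t"
  show "times_differentiable_at d (psi_Clayton \<theta>) t"
    by (rule derivatives_psi_Clayton(1) [OF t])
  show "(-1) ^ d * (deriv ^^ d) (psi_Clayton \<theta>) t
      = falling_fact (real d - 1 + 1 / \<theta>) d * (1 + t) powr (- (real d + 1 / \<theta>))"
    unfolding falling_fact_pochhammer by (rule derivatives_psi_Clayton(2) [OF t])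
  show prod: "falling_fact (real d - 1 + 1 / \<theta>) d = (\<Prod>k<d. real k + 1 / \<theta>)"
    unfolding falling_fact_pochhammer
    by (simp add: pochhammer_prod lessThan_atLeast0 add.commute)
  have "1 / \<theta> \<notin> \<int>\<^sub>\<le>\<^sub>0"
    using \<theta> by (auto dest!: nonpos_Ints_nonpos simp: field_simps)
  then show "(\<Prod>k<d. real k + 1 / \<theta>) = Gamma (real d + 1 / \<theta>) / Gamma (1 / \<theta>)"
    unfolding prod [symmetric] falling_fact_pochhammer
    by (simp add: pochhammer_Gamma add.commute)
next
  fix \<theta> t :: real and d :: nat
  assume "\<theta> > 0" "0 < t"
  then show "times_differentiable_at d (psi_Frank \<theta>) t"
    and "(-1) ^ d * (deriv ^^ d) (psi_Frank \<theta>) t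
      = 1 / \<theta> * polylog (- (real d - 1)) ((1 - exp (- \<theta>)) * exp (- t))"
    by (rule derivatives_psi_Frank)+
next
  fix \<theta> t :: real and d :: nat
  assume "1 \<le> d" "0 < t"
  then show "times_differentiable_at d (psi_Gumbel \<theta>) t"
    and "(-1) ^ d * (deriv ^^ d) (psi_Gumbel \<theta>) t
      = psi_Gumbel \<theta> t / t ^ d * P_Gumbel d \<theta> (t powr (1 / \<theta>))"
    by (rule derivatives_psi_Gumbel)+
next
  fix \<theta> :: real and d k :: nat
  assume "k \<in> {1..d}"
  then show "a_Gumbel d k \<theta> = fact d / fact k *
      (\<Sum>j=1..k. real (k choose j) * ((1 / \<theta> * real j) gchoose d) * (-1) ^ (d - j))"
    by (intro a_Gumbel_closed_form) auto
next
  fix \<theta> t :: real and d :: nat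
  assume "1 \<le> d" "0 < t"
  then show "times_differentiable_at d (psi_Joe \<theta>) t"
    and "(-1) ^ d * (deriv ^^ d) (psi_Joe \<theta>) t
      = exp (- t) / (\<theta> * (1 - exp (- t)) powr (1 - 1 / \<theta>))
        * P_Joe d \<theta> (exp (- t) / (1 - exp (- t)))"
    by (rule derivatives_psi_Joe)+
next
  fix \<theta> :: real and d k :: nat
  assume k: "k \<in> {1..d}"
  show "a_Joe d k \<theta> = real (Stirling d k) * (Gamma (real k - 1 / \<theta>) / Gamma (1 - 1 / \<theta>))"
    if "\<theta> > 1"
    using that k by (intro a_Joe_Gamma) auto
  show "((\<lambda>\<theta>'. real (Stirling d k) * (Gamma (real k - 1 / \<theta>') / Gamma (1 - 1 / \<theta>')))
      \<longlongrightarrow> a_Joe d k \<theta>) (at_right 1)" if "\<theta> = 1"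
    unfolding that using k by (intro a_Joe_Gamma_tendsto) auto
qed

end
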